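(* Let $C\in\mathbb{S}[t]$ be a generic monic quadratic split quaternion polynomial with two complementary factorizations $C=(t-h_1)(t-h_2)=(t-k_1)(t-k_2)$, where $h_1,h_2,k_1,k_2\in\mathbb{S}$. Put $H_1=[h_1-\overline{h_1}]$, $H_2=[h_2-\overline{h_2}]$, $K_1=[k_1-\overline{k_1}]$, $K_2=[k_2-\overline{k_2}]$ (the revolute joints of the four-bar linkage $\mathcal{F}(H_1,K_1;K_2,H_2)$), and suppose that these points are non-null. Then opposite sides of the linkage have equal quadrances: $$q(H_1,H_2)=q(K_1,K_2)\quad\text{and}\quad q(H_1,K_1)=q(H_2,K_2).$$
   Context: Split quaternions: $\mathbb{S}$ is the real associative algebra with basis $1,\mathbf{i},\mathbf{j},\mathbf{k}$ and relations $\mathbf{i}^2=-1$, $\mathbf{j}^2=\mathbf{k}^2=1$, $\mathbf{i}\mathbf{j}\mathbf{k}=1$. The conjugate of $h=h_0+h_1\mathbf{i}+h_2\mathbf{j}+h_3\mathbf{k}$ is $\overline{h}=h_0-h_1\mathbf{i}-h_2\mathbf{j}-h_3\mathbf{k}$, and $h\overline{h}=h_0^2+h_1^2-h_2^2-h_3^2\in\mathbb{R}$. $\mathbb{S}[t]$ is the ring of polynomials over $\mathbb{S}$ in which $t$ commutes with all coefficients. For $C=\sum c_\ell t^\ell$, $\overline{C}=\sum\overline{c_\ell}t^\ell$; then $C\overline{C}\in\mathbb{R}[t]$. Generic: a monic quadratic $C=t^2+c_1t+c_0\in\mathbb{S}[t]$ is generic if (i) its coefficients $1,c_1,c_0$ are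 linearly independent over $\mathbb{R}$, and (ii) for every real monic quadratic factor $M$ of $C\overline{C}$ the linear polynomial $C-M=r_1t+r_0$ has a unique zero, i.e. there is exactly one $h\in\mathbb{S}$ with $r_1h+r_0=0$. Complementary: two factorizations $C=(t-h_1)(t-h_2)=(t-k_1)(t-k_2)$ are complementary if $C\overline{C}=(t-h_1)(t-\overline{h_1})(t-k_1)(t-\overline{k_1})$. Geometry: $V$ is the 3-dimensional real vector space of split quaternions with zero real part, with inner product $\langle a,b\rangle=\tfrac12(a\overline{b}+b\overline{a})$. $P^2$ is the projective plane over $V$ and $[a]$ is the point represented by $a\in V\setminus\{0\}$. A point $[a]$ is null if $\langle a,a\rangle=0$. The quadrance of two non-null points is $q([a],[b])=1-\dfrac{\langle a,b\rangle^2}{\langle a,a\rangle\langle b,b\rangle}$. *)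

theory Defs
  imports Complex_Main "HOL-Library.Poly_Mapping"
begin

section \<open>Split quaternions\<close>

datatype squat = SQuat (sq0: real) (sq1: real) (sq2: real) (sq3: real)

lemma squat_eq_iff:
  "a = b \<longleftrightarrow> sq0 a = sq0 b \<and> sq1 a = sq1 b \<and> sq2 a = sq2 b \<and> sq3 a = sq3 b"
  by (cases a; cases b) simp

instantiation squat :: real_algebra_1
begin

definition "0 = SQuat 0 0 0 0"
definition "1 = SQuat 1 0 0 0"
definition "a + b = SQuat (sq0 a + sq0 b) (sq1 a + sq1 b) (sq2 a + sq2 b) (sq3 a + sq3 b)"
definition "a - b = SQuat (sq0 a - sq0 b) (sq1 a - sq1 b) (sq2 a - sq2 b) (sq3 a - sq3 b)"
definition "- a = SQuat (- sq0 a) (- sq1 a) (- sq2 a) (- sq3 a)" for a :: squat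
definition "r *\<^sub>R a = SQuat (r * sq0 a) (r * sq1 a) (r * sq2 a) (r * sq3 a)"

text \<open>The table follows from $i^2 = -1$, $j^2 = k^2 = 1$, $ijk = 1$:
  $ij = k = -ji$, $jk = -i = -kj$, $ki = j = -ik$; see \<open>squat_relations\<close> below.\<close>
definition "a * b = SQuat
  (sq0 a * sq0 b - sq1 a * sq1 b + sq2 a * sq2 b + sq3 a * sq3 b)
  (sq0 a * sq1 b + sq1 a * sq0 b - sq2 a * sq3 b + sq3 a * sq2 b)
  (sq0 a * sq2 b + sq2 a * sq0 b - sq1 a * sq3 b + sq3 a * sq1 b)
  (sq0 a * sq3 b + sq3 a * sq0 b + sq1 a * sq2 b - sq2 a * sq1 b)"

instance
  by standard
    (auto simp: squat_eq_iff zero_squat_def one_squat_def plus_squat_def minus_squat_def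
      uminus_squat_def scaleR_squat_def times_squat_def algebra_simps)

end

lemma squat_sel [simp]:
  "sq0 0 = 0" "sq1 0 = 0" "sq2 0 = 0" "sq3 0 = 0"
  "sq0 1 = 1" "sq1 1 = 0" "sq2 1 = 0" "sq3 1 = 0"
  "sq0 (a + b) = sq0 a + sq0 b" "sq1 (a + b) = sq1 a + sq1 b"
  "sq2 (a + b) = sq2 a + sq2 b" "sq3 (a + b) = sq3 a + sq3 b"
  "sq0 (a - b) = sq0 a - sq0 b" "sq1 (a - b) = sq1 a - sq1 b"
  "sq2 (a - b) = sq2 a - sq2 b" "sq3 (a - b) = sq3 a - sq3 b"
  "sq0 (- a) = - sq0 a" "sq1 (- a) = - sq1 a" "sq2 (- a) = - sq2 a" "sq3 (- a) = - sq3 a"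
  "sq0 (r *\<^sub>R a) = r * sq0 a" "sq1 (r *\<^sub>R a) = r * sq1 a"
  "sq2 (r *\<^sub>R a) = r * sq2 a" "sq3 (r *\<^sub>R a) = r * sq3 a"
  "sq0 (a * b) = sq0 a * sq0 b - sq1 a * sq1 b + sq2 a * sq2 b + sq3 a * sq3 b"
  "sq1 (a * b) = sq0 a * sq1 b + sq1 a * sq0 b - sq2 a * sq3 b + sq3 a * sq2 b"
  "sq2 (a * b) = sq0 a * sq2 b + sq2 a * sq0 b - sq1 a * sq3 b + sq3 a * sq1 b"
  "sq3 (a * b) = sq0 a * sq3 b + sq3 a * sq0 b + sq1 a * sq2 b - sq2 a * sq1 b"
  by (simp_all add: zero_squat_def one_squat_def plus_squat_def minus_squat_def
      uminus_squat_def scaleR_squat_def times_squat_def)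

lemma squat_of_real: "of_real r = SQuat r 0 0 0"
  by (simp add: of_real_def squat_eq_iff)

lemma squat_relations:
  defines "i \<equiv> SQuat 0 1 0 0" and "j \<equiv> SQuat 0 0 1 0" and "k \<equiv> SQuat 0 0 0 1"
  shows "i * i = - 1" "j * j = 1" "k * k = 1" "i * j * k = 1"
    and "h = sq0 h *\<^sub>R 1 + sq1 h *\<^sub>R i + sq2 h *\<^sub>R j + sq3 h *\<^sub>R k"
  by (simp_all add: squat_eq_iff i_def j_def k_def)

definition sconj :: "squat \<Rightarrow> squat" where
  "sconj h = SQuat (sq0 h) (- sq1 h) (- sq2 h) (- sq3 h)"

lemma squat_mult_sconj:
  "h * sconj h = of_real ((sq0 h)\<^sup>2 + (sq1 h)\<^sup>2 - (sq2 h)\<^sup>2 - (sq3 h)\<^sup>2)"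
  by (simp add: squat_eq_iff sconj_def squat_of_real power2_eq_square)

section \<open>Split quaternion polynomials\<close>

text \<open>The type of univariate polynomials in the library is a ring only over commutative
  coefficients. Finitely supported maps from the exponents, with the convolution product, give
  the polynomial ring with central indeterminate over an arbitrary ring.\<close>
type_synonym squat_poly = "nat \<Rightarrow>\<^sub>0 squat"

abbreviation coeff :: "squat_poly \<Rightarrow> nat \<Rightarrow> squat" where
  "coeff \<equiv> Poly_Mapping.lookup"

definition tvar :: squat_poly where
  "tvar = Poly_Mapping.single 1 1"

definition const :: "squat \<Rightarrow> squat_poly" where
  "const h = Poly_Mapping.single 0 h"

definition pconj :: "squat_poly \<Rightarrow> squat_poly" where
  "pconj P = Poly_Mapping.map sconj P"

lemma coeff_pconj: "coeff (pconj P) n = sconj (coeff P n)"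
  by (simp add: pconj_def Poly_Mapping.map.rep_eq when_def sconj_def zero_squat_def)

definition real_poly :: "squat_poly \<Rightarrow> bool" where
  "real_poly P \<longleftrightarrow> (\<forall>n. coeff P n \<in> \<real>)"

definition monic_quadratic :: "squat_poly \<Rightarrow> bool" where
  "monic_quadratic P \<longleftrightarrow> (\<exists>c1 c0. P = tvar ^ 2 + const c1 * tvar + const c0)"

text \<open>In \<open>generic\<close>, \<open>distinct\<close> is needed because linear independence is meant for the
  family of coefficients, not just for their set. For monic quadratic \<open>C\<close> and \<open>M\<close> the
  difference \<open>C - M\<close> is \<open>r1 t + r0\<close> with the coefficients used below.\<close>
definition generic :: "squat_poly \<Rightarrow> bool" where
  "generic C \<longleftrightarrow>
     monic_quadratic C \<and>
     distinct [1, coeff C 1, coeff C 0] \<and> independent {1, coeff C 1, coeff C 0} \<and>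
     (\<forall>M. real_poly M \<and> monic_quadratic M \<and> (\<exists>Q. real_poly Q \<and> C * pconj C = M * Q) \<longrightarrow>
        (\<exists>!h. coeff (C - M) 1 * h + coeff (C - M) 0 = 0))"

definition complementary :: "squat_poly \<Rightarrow> squat \<Rightarrow> squat \<Rightarrow> squat \<Rightarrow> squat \<Rightarrow> bool" where
  "complementary C h1 h2 k1 k2 \<longleftrightarrow>
     C = (tvar - const h1) * (tvar - const h2) \<and>
     C = (tvar - const k1) * (tvar - const k2) \<and>
     C * pconj C =
       (tvar - const h1) * (tvar - const (sconj h1)) * (tvar - const k1) * (tvar - const (sconj k1))"

section \<open>The projective plane over the vectorial split quaternions\<close>

definition vectorial :: "squat set" where
  "vectorial = {a. sq0 a = 0}"

text \<open>The element \<open>(a conj(b) + b conj(a)) / 2\<close> is real, so its scalar part is its value.\<close>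
definition sinner :: "squat \<Rightarrow> squat \<Rightarrow> real" where
  "sinner a b = sq0 ((1/2) *\<^sub>R (a * sconj b + b * sconj a))"

lemma of_real_sinner: "of_real (sinner a b) = (1/2) *\<^sub>R (a * sconj b + b * sconj a)"
  by (simp add: sinner_def squat_eq_iff sconj_def squat_of_real)

lemma sinner_eq: "sinner a b = sq0 a * sq0 b + sq1 a * sq1 b - sq2 a * sq2 b - sq3 a * sq3 b"
  by (simp add: sinner_def sconj_def)

definition proj_rel :: "squat \<Rightarrow> squat \<Rightarrow> bool" where
  "proj_rel a b \<longleftrightarrow> a \<in> vectorial - {0} \<and> b \<in> vectorial - {0} \<and> (\<exists>r::real. b = r *\<^sub>R a)"

lemma proj_rel_scale:
  assumes "proj_rel a b"
  obtains r where "r \<noteq> 0" "b = r *\<^sub>R a"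
  using assms by (auto simp: proj_rel_def)

text \<open>The quotient is partial: \<open>point a\<close> is meaningful only for \<open>a \<in> vectorial - {0}\<close>.\<close>
quotient_type proj_plane = squat / partial: proj_rel
  morphisms rep_point point
proof (rule part_equivpI)
  show "\<exists>a. proj_rel a a"
    by (rule exI[of _ "SQuat 0 1 0 0"])
      (auto simp: proj_rel_def vectorial_def squat_eq_iff intro: exI[of _ 1])
  show "symp proj_rel"
  proof (rule sympI)
    fix a b assume ab: "proj_rel a b"
    then obtain r where "r \<noteq> 0" "b = r *\<^sub>R a" by (rule proj_rel_scale)
    then have "a = inverse r *\<^sub>R b" by simp
    with ab show "proj_rel b a" by (auto simp: proj_rel_def)
  qed
  show "transp proj_rel"
    by (rule transpI) (auto simp: proj_rel_def)
qed

lemma sinner_scaleR: "sinner (r *\<^sub>R a) (s *\<^sub>R b) = r * s * sinner a b"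
  by (simp add: sinner_eq algebra_simps)

lift_definition null_point :: "proj_plane \<Rightarrow> bool" is "\<lambda>a. sinner a a = 0"
  by (auto elim!: proj_rel_scale simp: sinner_scaleR)

text \<open>Meaningful only for two non-null points.\<close>
lift_definition quadrance :: "proj_plane \<Rightarrow> proj_plane \<Rightarrow> real"
  is "\<lambda>a b. 1 - (sinner a b)\<^sup>2 / (sinner a a * sinner b b)"
  by (auto elim!: proj_rel_scale simp: sinner_scaleR power2_eq_square)

end

(* Comparing the coefficients of t^3 and t^2 in the norm polynomial shows that h1, k2 have equal
   trace and norm, and so do h2, k1; no cancellation of polynomials is needed. Hence the vector
   parts u1, u2, v1, v2 of h1, h2, k1, k2 satisfy |u1| = |v2|, |u2| = |v1| and u1 + u2 = v1 + v2.
   Polarizing |u1 + u2| = |v1 + v2| and |u1 - v1| = |v2 - u2| gives both equalities. *)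
theory Submission
  imports Defs
begin

text \<open>Written as a sum of monomials so that products expand by \<open>mult_single\<close> and
  coefficients can be read off directly.\<close>

definition quad_poly :: "squat \<Rightarrow> squat \<Rightarrow> squat_poly" where
  "quad_poly p q = Poly_Mapping.single 2 1 + Poly_Mapping.single 1 p + Poly_Mapping.single 0 q"

lemma linear_mult_linear:
  "(tvar - const a) * (tvar - const b) = quad_poly (- (a + b)) (a * b)"
  by (simp add: tvar_def const_def quad_poly_def algebra_simps mult_single single_uminus
      single_diff numeral_2_eq_2)

lemma coeff_quad_poly:
  "coeff (quad_poly p q) n = (if n = 2 then 1 else if n = 1 then p else if n = 0 then q else 0)"
  by (simp add: quad_poly_def lookup_add lookup_single when_def)

lemma pconj_quad_poly: "pconj (quad_poly p q) = quad_poly (sconj p) (sconj q)"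
  by (rule poly_mapping_eqI)
    (simp add: coeff_pconj coeff_quad_poly, simp add: sconj_def squat_eq_iff)

lemma coeff_quad_poly_mult:
  "coeff (quad_poly p q * quad_poly r s) 3 = p + r"
  "coeff (quad_poly p q * quad_poly r s) 2 = q + s + p * r"
  by (simp_all add: quad_poly_def distrib_left distrib_right mult_single lookup_add lookup_single
      algebra_simps)

text \<open>The real number \<open>h * sconj h\<close>, by \<open>squat_mult_sconj\<close>.\<close>

definition snorm :: "squat \<Rightarrow> real" where
  "snorm h = (sq0 h)\<^sup>2 + (sq1 h)\<^sup>2 - (sq2 h)\<^sup>2 - (sq3 h)\<^sup>2"

lemma complementary_quad_poly:
  assumes "complementary C h1 h2 k1 k2"
  shows "C = quad_poly (- (h1 + h2)) (h1 * h2)" "C = quad_poly (- (k1 + k2)) (k1 * k2)"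
  using assms unfolding complementary_def linear_mult_linear by blast+

lemma complementary_sum:
  assumes "complementary C h1 h2 k1 k2"
  shows "h1 + h2 = k1 + k2"
proof -
  have "coeff (quad_poly (- (h1 + h2)) (h1 * h2)) 1 = coeff (quad_poly (- (k1 + k2)) (k1 * k2)) 1"
    using complementary_quad_poly[OF assms] by metis
  then show ?thesis by (simp only: coeff_quad_poly) (simp add: squat_eq_iff)
qed

text \<open>Both \<open>C * pconj C\<close> and its complementary form are products of two
  quadratics. Their t^3 coefficients are -2 times the sum of the scalar parts of \<open>h1\<close>,
  \<open>h2\<close> and of \<open>h1\<close>, \<open>k1\<close> respectively; once these scalar
  parts agree, the t^2 coefficients differ only in \<open>snorm h2\<close> against
  \<open>snorm k1\<close>.\<close>

lemma complementary_trace_norm: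
  assumes "complementary C h1 h2 k1 k2"
  shows "sq0 k1 = sq0 h2" "snorm k1 = snorm h2"
proof -
  let ?P = "quad_poly (- (h1 + h2)) (h1 * h2) * quad_poly (sconj (- (h1 + h2))) (sconj (h1 * h2))"
  let ?Q = "quad_poly (- (h1 + sconj h1)) (h1 * sconj h1)
    * quad_poly (- (k1 + sconj k1)) (k1 * sconj k1)"
  have "C * pconj C = ((tvar - const h1) * (tvar - const (sconj h1)))
      * ((tvar - const k1) * (tvar - const (sconj k1)))"
    using assms unfolding complementary_def mult.assoc by blast
  then have PQ: "?P = ?Q"
    by (simp only: complementary_quad_poly(1)[OF assms] pconj_quad_poly linear_mult_linear)
  \<comment> \<open>The coefficients compared are real, so passing to \<open>sq0\<close> loses
    nothing.\<close>
  have "sq0 (coeff ?P 3) = sq0 (coeff ?Q 3)" by (simp only: PQ)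
  then show trace: "sq0 k1 = sq0 h2"
    by (simp only: coeff_quad_poly_mult) (simp add: sconj_def)
  have "sq0 (coeff ?P 2) = sq0 (coeff ?Q 2)" by (simp only: PQ)
  then show "snorm k1 = snorm h2"
    by (simp only: coeff_quad_poly_mult)
      (simp add: sconj_def snorm_def trace power2_eq_square algebra_simps)
qed

lemma complementary_norm_sum:
  assumes "complementary C h1 h2 k1 k2"
  shows "snorm k1 + snorm k2 + 4 * sq0 k1 * sq0 k2 = snorm h1 + snorm h2 + 4 * sq0 h1 * sq0 h2"
proof -
  \<comment> \<open>The mixed terms combine to twice the scalar part of
    \<open>a * (b + sconj b)\<close>, and \<open>b + sconj b\<close> is the real number
    \<open>2 * sq0 b\<close>.\<close>
  have norm: "sq0 (coeff (quad_poly (- (a + b)) (a * b) * pconj (quad_poly (- (a + b)) (a * b))) 2)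
      = snorm a + snorm b + 4 * sq0 a * sq0 b" for a b
    by (simp only: pconj_quad_poly coeff_quad_poly_mult)
      (simp add: sconj_def snorm_def power2_eq_square algebra_simps)
  have "quad_poly (- (h1 + h2)) (h1 * h2) = quad_poly (- (k1 + k2)) (k1 * k2)"
    using complementary_quad_poly[OF assms] by metis
  then show ?thesis
    using norm[of h1 h2] norm[of k1 k2] by metis
qed

text \<open>The quotient is partial, so unfolding the lifted function requires both representatives
  to be related to themselves; the scaling factor is 1.\<close>

lemma quadrance_point:
  assumes "a \<in> vectorial - {0}" "b \<in> vectorial - {0}"
  shows "quadrance (point a) (point b) = 1 - (sinner a b)\<^sup>2 / (sinner a a * sinner b b)"
proof (rule quadrance.abs_eq)
  show "proj_rel a a" "proj_rel b b"
    using assms by (auto simp: proj_rel_def intro: exI[of _ 1])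
qed

lemma vectorial_diff_sconj: "h - sconj h \<in> vectorial"
  by (simp add: vectorial_def sconj_def)

text \<open>\<open>h - sconj h\<close> is twice the vector part of \<open>h\<close>, whence the
  factor 4.\<close>

lemma sinner_diff_sconj_self: "sinner (h - sconj h) (h - sconj h) = 4 * (snorm h - (sq0 h)\<^sup>2)"
  by (simp add: sinner_eq sconj_def snorm_def power2_eq_square)

lemma sinner_commute: "sinner a b = sinner b a"
  by (simp add: sinner_eq mult.commute)

lemma sinner_polarization:
  "2 * sinner a b = sinner (a + b) (a + b) - sinner a a - sinner b b"
  "2 * sinner a b = sinner a a + sinner b b - sinner (a - b) (a - b)"
  by (simp_all add: sinner_eq algebra_simps)

theorem theorem1:
  fixes C :: squat_poly and h1 h2 k1 k2 :: squat and H1 H2 K1 K2 :: proj_plane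
  assumes "generic C"
    and "complementary C h1 h2 k1 k2"
    and "h1 - sconj h1 \<noteq> 0" "h2 - sconj h2 \<noteq> 0" "k1 - sconj k1 \<noteq> 0" "k2 - sconj k2 \<noteq> 0"
    and "H1 = point (h1 - sconj h1)" "H2 = point (h2 - sconj h2)"
    and "K1 = point (k1 - sconj k1)" "K2 = point (k2 - sconj k2)"
    and "\<not> null_point H1" "\<not> null_point H2" "\<not> null_point K1" "\<not> null_point K2"
  shows "quadrance H1 H2 = quadrance K1 K2 \<and> quadrance H1 K1 = quadrance H2 K2"
proof -
  define u1 u2 v1 v2 where uv: "u1 = h1 - sconj h1" "u2 = h2 - sconj h2"
    "v1 = k1 - sconj k1" "v2 = k2 - sconj k2"
  have ne: "u1 \<in> vectorial - {0}" "u2 \<in> vectorial - {0}"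
    "v1 \<in> vectorial - {0}" "v2 \<in> vectorial - {0}"
    using assms(3-6) by (simp_all add: uv vectorial_diff_sconj)
  note sum = complementary_sum[OF assms(2)]
  note trace1 = complementary_trace_norm(1)[OF assms(2)]
  note norm1 = complementary_trace_norm(2)[OF assms(2)]
  have trace2: "sq0 k2 = sq0 h1"
    using sum trace1 by (simp add: squat_eq_iff)
  have norm2: "snorm k2 = snorm h1"
    using complementary_norm_sum[OF assms(2)] trace1 trace2 norm1 by simp
  have eq1: "sinner v1 v1 = sinner u2 u2" and eq2: "sinner v2 v2 = sinner u1 u1"
    by (simp_all add: uv sinner_diff_sconj_self trace1 trace2 norm1 norm2)
  have add: "u1 + u2 = v1 + v2"
    using sum by (simp add: uv squat_eq_iff sconj_def)
  \<comment> \<open>The order \<open>v2 - u2\<close> pairs \<open>u1\<close> with \<open>v2\<close>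
    and \<open>v1\<close> with \<open>u2\<close>, the vectors of equal norm.\<close>
  then have diff: "u1 - v1 = v2 - u2"
    by (simp add: algebra_simps)
  have "sinner u1 u2 = sinner v1 v2"
    using sinner_polarization(1)[of u1 u2] sinner_polarization(1)[of v1 v2]
    by (simp add: add eq1 eq2)
  moreover have "sinner u1 v1 = sinner u2 v2"
    using sinner_polarization(2)[of u1 v1] sinner_polarization(2)[of v2 u2]
    by (simp add: diff eq1 eq2 sinner_commute[of u2 v2])
  ultimately show ?thesis
    \<comment> \<open>By \<open>eq1\<close> and \<open>eq2\<close>, all four denominators equal
      \<open>sinner u1 u1 * sinner u2 u2\<close> up to the order of the factors.\<close>
    unfolding assms(7-10) uv[symmetric]
    by (simp add: quadrance_point[OF ne(1,2)] quadrance_point[OF ne(3,4)]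
      quadrance_point[OF ne(1,3)] quadrance_point[OF ne(2,4)] eq1 eq2 mult.commute)
qed

end
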